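(* For all $k \in \mathbb{N}$, $\mu(k+1) \leq \mu(k) + 1$.
   Context: $\mathbb{N}$ denotes the set of positive integers. Fix an infinite set $D_0$ and recursively let $D_{n+1}$ be the set of finite non-empty subsets of $D_n$, for $n \geq 0$. For $k \geq 1$ and $n \geq 0$, define a set $\mathcal{F}^{(k)}_n$ of functions $D_0^k \to D_n$ by recursion on $n$: $\mathcal{F}^{(k)}_0$ is the set of the $k$ projections $(x_1,\dots,x_k) \mapsto x_i$ ($1 \leq i \leq k$); and $\mathcal{F}^{(k)}_{n+1}$ is the set of those functions $D_0^k \to D_{n+1}$ of the form $\mathbf{x} \mapsto \{g(\mathbf{x}) : g \in \mathcal{G}\}$ for some non-empty $\mathcal{G} \subseteq \mathcal{F}^{(k)}_n$. A pair $(k,n) \in \mathbb{N} \times \mathbb{N}$ is called good if $\mathcal{F}^{(k)}_n$ contains an injective function. For $k \in \mathbb{N}$, $\mu(k)$ is the least $n \in \mathbb{N}$ such that $(k,n)$ is good (for every $k \in \mathbb{N}$ such an $n$ exists, so $\mu$ is well-defined). *)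

theory Defs
  imports Main "HOL-Library.FSet" "HOL-Library.FuncSet"
begin

text \<open>
  The sets \<open>D\<^sub>n\<close> have different types for different \<open>n\<close>; they are realised as subsets of one type of
  well-founded trees over the atoms \<open>'a\<close>, in which a node is the (unordered, repetition-free) finite
  set of its children, so that equality of nodes is extensional equality of sets.
\<close>
datatype 'a nested = Atom 'a | Fin "'a nested fset"

fun members :: "'a nested \<Rightarrow> 'a nested set" where
  "members (Atom a) = {}"
| "members (Fin S) = fset S"

fun level :: "'a set \<Rightarrow> nat \<Rightarrow> 'a nested set" where
  "level D 0 = Atom ` D"
| "level D (Suc n) = {Fin S | S. fset S \<noteq> {} \<and> fset S \<subseteq> level D n}"

definition tuples :: "'a set \<Rightarrow> nat \<Rightarrow> (nat \<Rightarrow> 'a) set" where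
  "tuples D k = {1..k} \<rightarrow>\<^sub>E D"

text \<open>
  Functions \<open>D\<^sub>0\<^sup>k \<rightarrow> D\<^sub>n\<close> are extensional (undefined off \<open>tuples D k\<close>), so HOL equality of elements of
  \<open>funs D k n\<close> is equality of functions on \<open>D\<^sub>0\<^sup>k\<close>.
\<close>
fun funs :: "'a set \<Rightarrow> nat \<Rightarrow> nat \<Rightarrow> ((nat \<Rightarrow> 'a) \<Rightarrow> 'a nested) set" where
  "funs D k 0 = {\<lambda>x\<in>tuples D k. Atom (x i) | i. i \<in> {1..k}}"
| "funs D k (Suc n) =
     {f \<in> tuples D k \<rightarrow>\<^sub>E level D (Suc n).
        \<exists>G. G \<noteq> {} \<and> G \<subseteq> funs D k n \<and> (\<forall>x\<in>tuples D k. members (f x) = {g x | g. g \<in> G})}"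

definition good :: "'a set \<Rightarrow> nat \<Rightarrow> nat \<Rightarrow> bool" where
  "good D k n \<longleftrightarrow> k \<ge> 1 \<and> n \<ge> 1 \<and> (\<exists>f\<in>funs D k n. inj_on f (tuples D k))"

definition mu :: "'a set \<Rightarrow> nat \<Rightarrow> nat" where
  "mu D k = (LEAST n. good D k n)"

end

theory Submission
  imports Defs
begin

text \<open>
  Goodness propagates along the diagonal: if \<open>k \<ge> 2\<close> and \<open>(k, n)\<close> is good, then so is
  \<open>(k + 1, n + 1)\<close>.  Let \<open>f\<close> encode \<open>k\<close>-tuples injectively at level \<open>n\<close>.  Renaming the variables
  of \<open>f\<close> does not change its level (lemma \<open>reindex_in_funs\<close>), so at level \<open>n + 1\<close> any fixed non-empty
  set of \<open>k\<close>-tuples whose entries are chosen from \<open>x\<^sub>1, \<dots>, x\<^bsub>k+1\<^esub>\<close> can be encoded.  Write \<open>x\<close> as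
  \<open>(p, u, v, w)\<close> with a prefix \<open>p\<close> of length \<open>k - 2\<close>, and encode the three tuples
  \<open>(p, u, v)\<close>, \<open>(p, u, w)\<close>, \<open>(p, v, w)\<close>, which arise by deleting one of the last three entries.  They
  share the prefix \<open>p\<close>, so \<open>p\<close> can be read off; and the set \<open>{(u, v), (u, w), (v, w)}\<close> determines
  \<open>(u, v, w)\<close>, also when some of the entries coincide (lemma \<open>ordered_pairs_determine_triple\<close>).

  For \<open>k = 1\<close> there is no room for this, since deleting an entry of a pair leaves a set of
  singletons that forgets the order.  Here Kuratowski's pair \<open>{{x}, {x, y}}\<close> shows that \<open>(2, 2)\<close> is
  good, while \<open>\<mu>(1) \<ge> 1\<close> by definition, so \<open>\<mu>(2) \<le> 2 \<le> \<mu>(1) + 1\<close>.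

  The argument needs \<open>(k, \<mu>(k))\<close> to be good, so some good pair must exist for each \<open>k\<close>: this is
  \<open>(1, 1)\<close> for \<open>k = 1\<close>, and the diagonal step applied repeatedly to \<open>(2, 2)\<close> gives \<open>(k, k)\<close>.
\<close>

section \<open>Collecting functions into a set-valued function\<close>

definition collect :: "'a set \<Rightarrow> nat \<Rightarrow> ((nat \<Rightarrow> 'a) \<Rightarrow> 'a nested) set \<Rightarrow> (nat \<Rightarrow> 'a) \<Rightarrow> 'a nested" where
  "collect D k G = (\<lambda>x\<in>tuples D k. Fin (Abs_fset ((\<lambda>g. g x) ` G)))"

lemma members_collect:
  assumes "finite G" "x \<in> tuples D k"
  shows "members (collect D k G x) = (\<lambda>g. g x) ` G"
  using assms by (simp add: collect_def Abs_fset_inverse)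

lemma funs_range: "funs D k n \<subseteq> tuples D k \<rightarrow>\<^sub>E level D n"
proof (cases n)
  case 0
  have "(\<lambda>x\<in>tuples D k. Atom (x i)) \<in> tuples D k \<rightarrow>\<^sub>E level D 0" if "i \<in> {1..k}" for i
    unfolding restrict_PiE_iff using that by (simp add: tuples_def PiE_iff)
  then show ?thesis
    unfolding 0 funs.simps by blast
next
  case (Suc m)
  show ?thesis
    unfolding Suc funs.simps(2) by (rule Collect_restrict)
qed

lemma funs_Suc_iff:
  "f \<in> funs D k (Suc n) \<longleftrightarrow> f \<in> tuples D k \<rightarrow>\<^sub>E level D (Suc n) \<and>
    (\<exists>G. G \<noteq> {} \<and> G \<subseteq> funs D k n \<and> (\<forall>x\<in>tuples D k. members (f x) = (\<lambda>g. g x) ` G))"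
  unfolding funs.simps(2) mem_Collect_eq Setcompr_eq_image by (rule refl)

lemma funs_SucI:
  assumes "f \<in> tuples D k \<rightarrow>\<^sub>E level D (Suc n)" "G \<noteq> {}" "G \<subseteq> funs D k n"
    and "\<And>x. x \<in> tuples D k \<Longrightarrow> members (f x) = (\<lambda>g. g x) ` G"
  shows "f \<in> funs D k (Suc n)"
  unfolding funs_Suc_iff using assms by (intro conjI exI[of _ G] ballI)

lemma collect_in_funs:
  assumes "finite G" "G \<noteq> {}" "G \<subseteq> funs D k n"
  shows "collect D k G \<in> funs D k (Suc n)"
proof -
  have "collect D k G x \<in> level D (Suc n)" if x: "x \<in> tuples D k" for x
  proof -
    have "(\<lambda>g. g x) ` G \<subseteq> level D n"
      using assms(3) funs_range[of D k n] x by blast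
    then show ?thesis
      using assms(1,2) x by (simp add: collect_def Abs_fset_inverse)
  qed
  then have "collect D k G \<in> tuples D k \<rightarrow>\<^sub>E level D (Suc n)"
    by (simp add: PiE_iff collect_def del: level.simps)
  then show ?thesis
    using assms(2,3) members_collect[OF assms(1)] by (rule funs_SucI)
qed

section \<open>Renaming variables\<close>

definition pullback :: "nat \<Rightarrow> (nat \<Rightarrow> nat) \<Rightarrow> (nat \<Rightarrow> 'a) \<Rightarrow> nat \<Rightarrow> 'a" where
  "pullback k s x = (\<lambda>i\<in>{1..k}. x (s i))"

definition reindex :: "'a set \<Rightarrow> nat \<Rightarrow> nat \<Rightarrow> (nat \<Rightarrow> nat) \<Rightarrow> ((nat \<Rightarrow> 'a) \<Rightarrow> 'b) \<Rightarrow> (nat \<Rightarrow> 'a) \<Rightarrow> 'b" where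
  "reindex D k l s f = (\<lambda>x\<in>tuples D l. f (pullback k s x))"

lemma pullback_in_tuples:
  assumes "s \<in> {1..k} \<rightarrow> {1..l}" "x \<in> tuples D l"
  shows "pullback k s x \<in> tuples D k"
  using assms unfolding pullback_def tuples_def by (auto simp: Pi_iff)

text \<open>
  Renaming commutes with the formation of sets and sends projections to projections, so it
  preserves every level of the hierarchy.
\<close>
lemma reindex_in_funs:
  assumes s: "s \<in> {1..k} \<rightarrow> {1..l}"
  shows "f \<in> funs D k n \<Longrightarrow> reindex D k l s f \<in> funs D l n"
proof (induction n arbitrary: f)
  case 0
  then obtain i where i: "i \<in> {1..k}" "f = (\<lambda>x\<in>tuples D k. Atom (x i))"
    by auto
  have "reindex D k l s f = (\<lambda>x\<in>tuples D l. Atom (x (s i)))"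
    unfolding reindex_def i(2)
  proof (rule restrict_ext)
    fix x assume "x \<in> tuples D l"
    then have "pullback k s x \<in> tuples D k"
      by (rule pullback_in_tuples[OF s])
    moreover have "pullback k s x i = x (s i)"
      using i(1) by (simp add: pullback_def)
    ultimately show "(\<lambda>x\<in>tuples D k. Atom (x i)) (pullback k s x) = Atom (x (s i))"
      by simp
  qed
  moreover have "s i \<in> {1..l}"
    using s i(1) by blast
  ultimately show ?case
    unfolding funs.simps by blast
next
  case (Suc n)
  from Suc.prems obtain G where f: "f \<in> tuples D k \<rightarrow>\<^sub>E level D (Suc n)"
    and G: "G \<noteq> {}" "G \<subseteq> funs D k n"
    and mem: "\<And>x. x \<in> tuples D k \<Longrightarrow> members (f x) = (\<lambda>g. g x) ` G"
    unfolding funs_Suc_iff by (elim conjE exE) (rule that, simp_all del: level.simps)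
  show ?case
  proof (rule funs_SucI)
    show "reindex D k l s f \<in> tuples D l \<rightarrow>\<^sub>E level D (Suc n)"
      using PiE_mem[OF f pullback_in_tuples[OF s]]
      by (simp add: reindex_def PiE_iff del: level.simps)
    show "reindex D k l s ` G \<noteq> {}" "reindex D k l s ` G \<subseteq> funs D l n"
      using G Suc.IH by blast+
    show "members (reindex D k l s f x) = (\<lambda>h. h x) ` reindex D k l s ` G"
      if x: "x \<in> tuples D l" for x
      using mem[OF pullback_in_tuples[OF s x]] x by (simp add: reindex_def image_image)
  qed
qed

section \<open>Short tuples\<close>

lemma good_two_two: "good D 2 2"
proof -
  let ?p = "\<lambda>i. \<lambda>x\<in>tuples D 2. Atom (x i)"
  let ?S = "collect D 2 {?p 1}" and ?T = "collect D 2 {?p 1, ?p 2}"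
  let ?F = "collect D 2 {?S, ?T}"
  have "{?p 1, ?p 2} \<subseteq> funs D 2 0"
    by auto
  then have "{?S, ?T} \<subseteq> funs D 2 (Suc 0)"
    using collect_in_funs[of "{?p 1}" D 2 0] collect_in_funs[of "{?p 1, ?p 2}" D 2 0] by blast
  then have F: "?F \<in> funs D 2 (Suc (Suc 0))"
    by (intro collect_in_funs) auto
  have members_F: "members ` members (?F x) = {{Atom (x 1)}, {Atom (x 1), Atom (x 2)}}"
    if "x \<in> tuples D 2" for x
    using that by (simp add: members_collect)
  have "inj_on ?F (tuples D 2)"
  proof (rule inj_onI)
    fix x y assume x: "x \<in> tuples D 2" and y: "y \<in> tuples D 2" and "?F x = ?F y"
    then have "{{Atom (x 1)}, {Atom (x 1), Atom (x 2)}} = {{Atom (y 1)}, {Atom (y 1), Atom (y 2)}}"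
      using members_F by metis
    then have "x 1 = y 1 \<and> x 2 = y 2"
      by (auto simp: doubleton_eq_iff)
    moreover have "i = 1 \<or> i = 2" if "i \<in> {1..2}" for i :: nat
      using that by auto
    ultimately show "x = y"
      using x y unfolding tuples_def by (metis PiE_ext)
  qed
  moreover have "?F \<in> funs D 2 2"
    using F unfolding numeral_2_eq_2 .
  ultimately show ?thesis
    unfolding good_def by (blast intro: one_le_numeral)
qed

section \<open>The diagonal step\<close>

text \<open>
  The first components give \<open>{u, v}\<close> and the second components give \<open>{v, w}\<close>.  The only ambiguity
  left between distinct triples is \<open>(a, b, a)\<close> against \<open>(b, a, b)\<close>, and there the pair of the outer
  entries, the loop \<open>(a, a)\<close> or \<open>(b, b)\<close>, tells them apart.  Using only \<open>(u, v)\<close> and \<open>(v, w)\<close>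
  would not be enough.
\<close>
lemma ordered_pairs_determine_triple:
  assumes "{(u, v), (u, w), (v, w)} = {(u', v'), (u', w'), (v', w')}"
  shows "u = u' \<and> v = v' \<and> w = w'"
proof -
  have "{u, v} = {u', v'}"
    using arg_cong[OF assms, of "image fst"] by simp
  moreover have "{v, w} = {v', w'}"
    using arg_cong[OF assms, of "image snd"] by simp
  moreover have "(u, w) \<in> {(u', v'), (u', w'), (v', w')}"
    unfolding assms[symmetric] by simp
  ultimately show ?thesis
    by (auto simp: doubleton_eq_iff)
qed

definition skip :: "nat \<Rightarrow> nat \<Rightarrow> nat" where
  "skip j i = (if i < j then i else Suc i)"

lemma skip_in_Pi: "skip j \<in> {1..k} \<rightarrow> {1..Suc k}"
  by (auto simp: skip_def)

text \<open>
  Deleting one of the last three entries leaves the first \<open>k - 2\<close> entries in place.  Hence each of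
  these coordinates takes a single value on the three shortened tuples, and only the last two
  coordinates carry the ambiguity that is resolved by the preceding fact about triples.
\<close>
lemma late_deletions_determine_tuple:
  assumes k: "k \<ge> 2"
    and x: "x \<in> tuples D (Suc k)" and y: "y \<in> tuples D (Suc k)"
    and eq: "(\<lambda>j. pullback k (skip j) x) ` {k - 1, k, Suc k}
      = (\<lambda>j. pullback k (skip j) y) ` {k - 1, k, Suc k}"
  shows "x = y"
proof -
  have proj_eq: "(\<lambda>j. h (pullback k (skip j) x)) ` {k - 1, k, Suc k}
    = (\<lambda>j. h (pullback k (skip j) y)) ` {k - 1, k, Suc k}" for h :: "(nat \<Rightarrow> 'a) \<Rightarrow> 'c"
    using arg_cong[OF eq, of "image h"] by (simp add: image_image)
  have prefix: "x i = y i" if "i \<in> {1..k - 2}" for i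
  proof -
    have "i \<in> {1..k}" "i < k - 1" "i < k" "i < Suc k"
      using that k by auto
    then show ?thesis
      using proj_eq[of "\<lambda>t. t i"] by (simp add: pullback_def skip_def)
  qed
  have k': "k - 1 \<in> {1..k}" "k \<in> {1..k}" "k - 1 < k" "\<not> k < k - 1" "Suc (k - 1) = k"
    using k by auto
  \<comment> \<open>The last two entries of the three shortened tuples; deleting the last entry first gives the
    three pairs in lexicographic order.\<close>
  have last_pairs: "(\<lambda>j. (pullback k (skip j) z (k - 1), pullback k (skip j) z k)) ` {k - 1, k, Suc k}
    = {(z (k - 1), z k), (z (k - 1), z (Suc k)), (z k, z (Suc k))}" for z :: "nat \<Rightarrow> 'a"
    using k' by (auto simp: pullback_def skip_def)
  have "x (k - 1) = y (k - 1) \<and> x k = y k \<and> x (Suc k) = y (Suc k)"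
    using proj_eq[of "\<lambda>t. (t (k - 1), t k)"] unfolding last_pairs
    by (rule ordered_pairs_determine_triple)
  moreover have "i \<in> {1..k - 2} \<or> i = k - 1 \<or> i = k \<or> i = Suc k" if "i \<in> {1..Suc k}" for i
    using that by auto
  ultimately show ?thesis
    using x y prefix unfolding tuples_def by (metis PiE_ext)
qed

lemma good_Suc_Suc:
  assumes k: "k \<ge> 2" and good: "good D k n"
  shows "good D (Suc k) (Suc n)"
proof -
  from good obtain f where f: "f \<in> funs D k n" and inj: "inj_on f (tuples D k)"
    unfolding good_def by blast
  let ?J = "{k - 1, k, Suc k}"
  let ?G = "(\<lambda>j. reindex D k (Suc k) (skip j) f) ` ?J"
  let ?F = "collect D (Suc k) ?G"
  have F: "?F \<in> funs D (Suc k) (Suc n)"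
    using reindex_in_funs[OF skip_in_Pi f] by (intro collect_in_funs) blast+
  have members_F: "members (?F x) = f ` (\<lambda>j. pullback k (skip j) x) ` ?J"
    if x: "x \<in> tuples D (Suc k)" for x
  proof -
    have "members (?F x) = (\<lambda>g. g x) ` ?G"
      by (rule members_collect) (use x in auto)
    then show ?thesis
      using x by (simp add: reindex_def)
  qed
  have "inj_on ?F (tuples D (Suc k))"
  proof (rule inj_onI)
    fix x y assume x: "x \<in> tuples D (Suc k)" and y: "y \<in> tuples D (Suc k)" and "?F x = ?F y"
    then have "f ` (\<lambda>j. pullback k (skip j) x) ` ?J = f ` (\<lambda>j. pullback k (skip j) y) ` ?J"
      using members_F by metis
    moreover have sub: "(\<lambda>j. pullback k (skip j) z) ` ?J \<subseteq> tuples D k" if "z \<in> tuples D (Suc k)" for z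
      using pullback_in_tuples[OF skip_in_Pi that] by blast
    ultimately have "(\<lambda>j. pullback k (skip j) x) ` ?J = (\<lambda>j. pullback k (skip j) y) ` ?J"
      using inj_on_image_eq_iff[OF inj sub[OF x] sub[OF y]] by simp
    then show "x = y"
      by (rule late_deletions_determine_tuple[OF k x y])
  qed
  moreover have "1 \<le> Suc k" "1 \<le> Suc n"
    by simp_all
  ultimately show ?thesis
    using F unfolding good_def by blast
qed

lemma good_diagonal: "k \<ge> 2 \<Longrightarrow> good D k k"
  by (induction k rule: dec_induct) (auto intro: good_two_two good_Suc_Suc)

lemma good_one_one: "good D 1 1"
proof -
  let ?p = "\<lambda>x\<in>tuples D 1. Atom (x 1)"
  let ?F = "collect D 1 {?p}"
  have F: "?F \<in> funs D 1 (Suc 0)"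
    by (intro collect_in_funs) auto
  have members_F: "members (?F x) = {Atom (x 1)}" if "x \<in> tuples D 1" for x
    using that by (simp add: members_collect)
  have "inj_on ?F (tuples D 1)"
  proof (rule inj_onI)
    fix x y assume x: "x \<in> tuples D 1" and y: "y \<in> tuples D 1" and "?F x = ?F y"
    then have "x 1 = y 1"
      using members_F by (metis nested.inject(1) singleton_inject)
    then show "x = y"
      by (intro PiE_ext[OF x[unfolded tuples_def] y[unfolded tuples_def]]) simp
  qed
  with F show ?thesis
    unfolding good_def One_nat_def by blast
qed

lemma good_mu:
  assumes "k \<ge> 1"
  shows "good D k (mu D k)"
proof -
  have "good D k k"
    using assms good_one_one good_diagonal[of k D] by (cases "k = 1") auto
  then show ?thesis
    unfolding mu_def by (rule LeastI)
qed

theorem lemma5p1: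
  fixes D :: "'a set" and k :: nat
  assumes "infinite D" and "k \<ge> 1"
  shows "mu D (k + 1) \<le> mu D k + 1"
proof (cases "k = 1")
  case True
  have "mu D 2 \<le> 2"
    unfolding mu_def by (rule Least_le) (rule good_two_two)
  moreover have "mu D 1 \<ge> 1"
    using good_mu[of 1 D] by (simp add: good_def)
  ultimately show ?thesis
    using True by (simp add: numeral_2_eq_2)
next
  case False
  with assms(2) have "k \<ge> 2"
    by simp
  then have "good D (k + 1) (mu D k + 1)"
    using good_Suc_Suc[OF _ good_mu[OF assms(2)]] by simp
  then show ?thesis
    unfolding mu_def by (rule Least_le)
qed

end
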